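(* Let $\mathfrak F=(X,R,E)$ be an $\mathbf{MK}$-frame. For every $\mathcal{L}_\exists$-formula $\varphi$, $\varphi$ is valid in $\mathfrak F$ if and only if $\varphi^t$ is valid in the Kripke bundle $\mathscr B(\mathfrak F)$.
   Context: An $\mathbf{MK}$-frame is $(X,R,E)$, $X\neq\varnothing$, $R\subseteq X^2$, $E$ an equivalence relation, with $x\mathrel Ey$, $y\mathrel Rz$ implying $x\mathrel Ru$, $u\mathrel Ez$ for some $u$. $\mathcal{L}_\exists$-formulas (letters, $\neg,\vee,\Diamond,\exists$) are evaluated in $\mathfrak F$ with $\Diamond$ via $R$ and $\exists$ via $E$; valid means true at all points under all valuations. The translation $(-)^t$ into first-order modal logic fixes a variable $x$ and unary predicates $p^*$: $p^t=p^*(x)$, commutes with $\neg,\vee,\Diamond$, $(\exists\varphi)^t=\exists x\varphi^t$. $\mathscr B(\mathfrak F)$ is the Kripke bundle $((X,R),\pi,(X/E,R_0))$ with $\pi$ the quotient map and $[x]\mathrel{R_0}[y]$ iff $x\mathrel Rz$ and $z\mathrel Ey$ for some $z$. A valuation $I$ on a bundle $((X,R),\pi,(X_0,R_0))$ assigns to each $m$-ary predicate $P$ and $w\in X_0$ a set $I_w(P)\subseteq(\pi^{-1}(w))^m$; at $w$, sentences with constants from $\pi^{-1}(w)$ are evaluated by: $w\models P(\vec a)$ iff $\vec a\in I_w(P)$; Boolean clauses classical; $w\models\exists x\psi$ iff $w\models\psi[a/x]$ for some $a\in\pi^{-1}(w)$; $w\models\Diamond\psi[\vec a/\vec x]$ iff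 there are $v\in R_0[w]$ and $b_i\in R[a_i]\cap\pi^{-1}(v)$ with $a_i=a_j\Rightarrow b_i=b_j$ such that $v\models\psi[\vec b/\vec x]$. A formula is valid in the bundle if its universal closure holds at every $w\in X_0$ under every valuation. *)

theory Defs
  imports Main
begin

section \<open>Monadic modal formulas and MK-frames\<close>

datatype 'p mfm =
    Letter 'p
  | MNeg "'p mfm"
  | MOr "'p mfm" "'p mfm"
  | MDia "'p mfm"
  | MEx "'p mfm"

definition MK_frame :: "'a set \<Rightarrow> 'a rel \<Rightarrow> 'a rel \<Rightarrow> bool" where
  "MK_frame X R E \<longleftrightarrow>
     X \<noteq> {} \<and> R \<subseteq> X \<times> X \<and> equiv X E \<and>
     (\<forall>x y z. (x, y) \<in> E \<and> (y, z) \<in> R \<longrightarrow> (\<exists>u. (x, u) \<in> R \<and> (u, z) \<in> E))"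

primrec mtrue :: "'a rel \<Rightarrow> 'a rel \<Rightarrow> ('p \<Rightarrow> 'a set) \<Rightarrow> 'a \<Rightarrow> 'p mfm \<Rightarrow> bool" where
  "mtrue R E V x (Letter p) \<longleftrightarrow> x \<in> V p"
| "mtrue R E V x (MNeg \<phi>) \<longleftrightarrow> \<not> mtrue R E V x \<phi>"
| "mtrue R E V x (MOr \<phi> \<psi>) \<longleftrightarrow> mtrue R E V x \<phi> \<or> mtrue R E V x \<psi>"
| "mtrue R E V x (MDia \<phi>) \<longleftrightarrow> (\<exists>y. (x, y) \<in> R \<and> mtrue R E V y \<phi>)"
| "mtrue R E V x (MEx \<phi>) \<longleftrightarrow> (\<exists>y. (x, y) \<in> E \<and> mtrue R E V y \<phi>)"

definition frame_valid :: "'a set \<Rightarrow> 'a rel \<Rightarrow> 'a rel \<Rightarrow> 'p mfm \<Rightarrow> bool" where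
  "frame_valid X R E \<phi> \<longleftrightarrow>
     (\<forall>V. (\<forall>p. V p \<subseteq> X) \<longrightarrow> (\<forall>x\<in>X. mtrue R E V x \<phi>))"


section \<open>First-order modal formulas\<close>

datatype 'p predsym = PredSym (arity: nat) 'p

datatype 'c trm = Var nat | Cst 'c

text \<open>
  Formulas of the first-order modal language, extended by individual constants
  from \<open>'c\<close>; \<open>csts \<phi>\<close> is the set of constants occurring in \<open>\<phi>\<close>, and
  \<open>map_csts b \<phi>\<close> replaces each constant \<open>a\<close> in \<open>\<phi>\<close> by \<open>b a\<close>.
\<close>

datatype (dead 'p, csts: 'c) fo =
    FPred "'p predsym" "'c trm list"
  | FNeg "('p, 'c) fo"
  | FOr "('p, 'c) fo" "('p, 'c) fo"
  | FDia "('p, 'c) fo"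
  | FEx nat "('p, 'c) fo"
  for map: map_csts

definition FAll :: "nat \<Rightarrow> ('p, 'c) fo \<Rightarrow> ('p, 'c) fo" where
  "FAll x \<phi> = FNeg (FEx x (FNeg \<phi>))"

primrec trm_vars :: "'c trm \<Rightarrow> nat set" where
  "trm_vars (Var x) = {x}"
| "trm_vars (Cst a) = {}"

primrec free_vars :: "('p, 'c) fo \<Rightarrow> nat set" where
  "free_vars (FPred P ts) = (\<Union>t\<in>set ts. trm_vars t)"
| "free_vars (FNeg \<phi>) = free_vars \<phi>"
| "free_vars (FOr \<phi> \<psi>) = free_vars \<phi> \<union> free_vars \<psi>"
| "free_vars (FDia \<phi>) = free_vars \<phi>"
| "free_vars (FEx x \<phi>) = free_vars \<phi> - {x}"

definition universal_closure :: "('p, 'c) fo \<Rightarrow> ('p, 'c) fo" where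
  "universal_closure \<phi> = foldr FAll (sorted_list_of_set (free_vars \<phi>)) \<phi>"

primrec trm_subst :: "nat \<Rightarrow> 'c \<Rightarrow> 'c trm \<Rightarrow> 'c trm" where
  "trm_subst x a (Var y) = (if y = x then Cst a else Var y)"
| "trm_subst x a (Cst c) = Cst c"

primrec subst :: "nat \<Rightarrow> 'c \<Rightarrow> ('p, 'c) fo \<Rightarrow> ('p, 'c) fo" where
  "subst x a (FPred P ts) = FPred P (map (trm_subst x a) ts)"
| "subst x a (FNeg \<phi>) = FNeg (subst x a \<phi>)"
| "subst x a (FOr \<phi> \<psi>) = FOr (subst x a \<phi>) (subst x a \<psi>)"
| "subst x a (FDia \<phi>) = FDia (subst x a \<phi>)"
| "subst x a (FEx y \<phi>) = FEx y (if y = x then \<phi> else subst x a \<phi>)"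

lemma size_subst [simp]: "size (subst x a \<phi>) = size \<phi>"
proof (induction \<phi>)
  case (FPred P ts)
  have "size (trm_subst x a t) = size t" for t
    by (cases t) auto
  then show ?case
    by (simp add: size_list_conv_sum_list comp_def)
qed auto

lemma size_map_csts [simp]: "size (map_csts b \<phi>) = size \<phi>"
proof (induction \<phi>)
  case (FPred P ts)
  have "size (map_trm b t) = size t" for t
    by (cases t) auto
  then show ?case
    by (simp add: size_list_conv_sum_list comp_def)
qed auto

primrec translation :: "nat \<Rightarrow> 'p mfm \<Rightarrow> ('p, 'c) fo" where
  "translation x (Letter p) = FPred (PredSym 1 p) [Var x]"
| "translation x (MNeg \<phi>) = FNeg (translation x \<phi>)"
| "translation x (MOr \<phi> \<psi>) = FOr (translation x \<phi>) (translation x \<psi>)"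
| "translation x (MDia \<phi>) = FDia (translation x \<phi>)"
| "translation x (MEx \<phi>) = FEx x (translation x \<phi>)"


section \<open>Kripke bundles\<close>

record ('a, 'w) kbundle =
  total :: "'a set"
  total_rel :: "'a rel"
  proj :: "'a \<Rightarrow> 'w"
  base :: "'w set"
  base_rel :: "'w rel"

definition fiber :: "('a, 'w) kbundle \<Rightarrow> 'w \<Rightarrow> 'a set" where
  "fiber B w = {a \<in> total B. proj B a = w}"

text \<open>The projection is a p-morphism onto the base frame.\<close>

definition kripke_bundle :: "('a, 'w) kbundle \<Rightarrow> bool" where
  "kripke_bundle B \<longleftrightarrow>
     total B \<noteq> {} \<and> total_rel B \<subseteq> total B \<times> total B \<and> base_rel B \<subseteq> base B \<times> base B \<and>
     proj B ` total B = base B \<and>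
     (\<forall>a b. (a, b) \<in> total_rel B \<longrightarrow> (proj B a, proj B b) \<in> base_rel B) \<and>
     (\<forall>a\<in>total B. \<forall>v. (proj B a, v) \<in> base_rel B \<longrightarrow>
        (\<exists>b. (a, b) \<in> total_rel B \<and> proj B b = v))"

definition bundle_valuation ::
  "('a, 'w) kbundle \<Rightarrow> ('w \<Rightarrow> 'p predsym \<Rightarrow> 'a list set) \<Rightarrow> bool" where
  "bundle_valuation B I \<longleftrightarrow>
     (\<forall>w\<in>base B. \<forall>P. I w P \<subseteq> {as. set as \<subseteq> fiber B w \<and> length as = arity P})"

text \<open>
  Truth of sentences with constants. In the clause for \<open>FDia\<close>, the tuple of
  constants of the sentence is replaced by a tuple of their successors in the
  fiber over \<open>v\<close>; equal constants must receive equal successors, so the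
  replacement is given by a function \<open>b\<close> on constants.
\<close>

function holds ::
  "('a, 'w) kbundle \<Rightarrow> ('w \<Rightarrow> 'p predsym \<Rightarrow> 'a list set) \<Rightarrow> 'w \<Rightarrow> ('p, 'a) fo \<Rightarrow> bool" where
  "holds B I w (FPred P ts) \<longleftrightarrow> (\<exists>as. ts = map Cst as \<and> as \<in> I w P)"
| "holds B I w (FNeg \<phi>) \<longleftrightarrow> \<not> holds B I w \<phi>"
| "holds B I w (FOr \<phi> \<psi>) \<longleftrightarrow> holds B I w \<phi> \<or> holds B I w \<psi>"
| "holds B I w (FDia \<phi>) \<longleftrightarrow>
     (\<exists>v b. (w, v) \<in> base_rel B \<and>
        (\<forall>a\<in>csts \<phi>. (a, b a) \<in> total_rel B \<and> b a \<in> fiber B v) \<and>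
        holds B I v (map_csts b \<phi>))"
| "holds B I w (FEx x \<phi>) \<longleftrightarrow> (\<exists>a\<in>fiber B w. holds B I w (subst x a \<phi>))"
  by pat_completeness auto
termination
  by (relation "measure (\<lambda>(B, I, w, \<phi>). size \<phi>)") auto

definition bundle_valid :: "('a, 'w) kbundle \<Rightarrow> ('p, 'a) fo \<Rightarrow> bool" where
  "bundle_valid B \<phi> \<longleftrightarrow>
     (\<forall>I. bundle_valuation B I \<longrightarrow> (\<forall>w\<in>base B. holds B I w (universal_closure \<phi>)))"


section \<open>The bundle of an MK-frame\<close>

definition frame_bundle :: "'a set \<Rightarrow> 'a rel \<Rightarrow> 'a rel \<Rightarrow> ('a, 'a set) kbundle" where
  "frame_bundle X R E =
     \<lparr> total = X,
       total_rel = R,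
       proj = (\<lambda>x. E `` {x}),
       base = X // E,
       base_rel = {(E `` {x}, E `` {y}) | x y.
         x \<in> X \<and> y \<in> X \<and> (\<exists>z. (x, z) \<in> R \<and> (z, y) \<in> E)} \<rparr>"

lemma frame_bundle_base_rel_iff:
  assumes "MK_frame X R E" "x \<in> X" "y \<in> X"
  shows "(E `` {x}, E `` {y}) \<in> base_rel (frame_bundle X R E) \<longleftrightarrow>
    (\<exists>z. (x, z) \<in> R \<and> (z, y) \<in> E)"
proof
  assume "(E `` {x}, E `` {y}) \<in> base_rel (frame_bundle X R E)"
  then obtain x' y' z where *: "E `` {x} = E `` {x'}" "E `` {y} = E `` {y'}"
    "x' \<in> X" "y' \<in> X" "(x', z) \<in> R" "(z, y') \<in> E"
    unfolding frame_bundle_def by auto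
  have E: "equiv X E" using assms by (simp add: MK_frame_def)
  have "(x, x') \<in> E" "(y', y) \<in> E"
    using * assms eq_equiv_class_iff[OF E] by metis+
  moreover obtain u where "(x, u) \<in> R" "(u, z) \<in> E"
    using assms(1) * \<open>(x, x') \<in> E\<close> unfolding MK_frame_def by blast
  ultimately show "\<exists>z. (x, z) \<in> R \<and> (z, y) \<in> E"
    using E * by (meson equivE transE)
qed (use assms in \<open>auto simp: frame_bundle_def\<close>)

lemma kripke_bundle_frame_bundle:
  assumes "MK_frame X R E"
  shows "kripke_bundle (frame_bundle X R E)"
proof -
  have E: "equiv X E" and R: "R \<subseteq> X \<times> X" and X: "X \<noteq> {}"
    using assms by (auto simp: MK_frame_def)
  have refl: "(x, x) \<in> E" if "x \<in> X" for x
    using E that by (meson equivE refl_onD)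
  have lift: "\<exists>b. (a, b) \<in> R \<and> E `` {b} = v"
    if "a \<in> X" and v: "(E `` {a}, v) \<in> base_rel (frame_bundle X R E)" for a v
  proof -
    from v obtain y where y: "y \<in> X" "v = E `` {y}"
      by (auto simp: frame_bundle_def)
    with v that obtain z where "(a, z) \<in> R" "(z, y) \<in> E"
      using frame_bundle_base_rel_iff[OF assms] by blast
    then show ?thesis using y equiv_class_eq[OF E] by blast
  qed
  have forth: "(E `` {a}, E `` {b}) \<in> base_rel (frame_bundle X R E)" if "(a, b) \<in> R" for a b
    using frame_bundle_base_rel_iff[OF assms] that R refl by blast
  have "base_rel (frame_bundle X R E) \<subseteq> X // E \<times> X // E"
    by (auto simp: frame_bundle_def quotient_def)
  moreover have "(\<lambda>x. E `` {x}) ` X = X // E"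
    by (auto simp: quotient_def)
  ultimately show ?thesis
    using X R lift forth unfolding kripke_bundle_def
    by (simp add: frame_bundle_def)
qed

end

theory Submission
  imports Defs
begin

text \<open>
  A valuation on the frame and the interpretation of the unary predicates on the bundle determine
  each other fibrewise, and under this correspondence truth of \<open>\<phi>\<close> at a point \<open>a\<close> is truth of
  \<open>\<phi>\<^sup>t[a/x]\<close> at the world below \<open>a\<close>. The only delicate case is \<open>\<Diamond>\<psi>\<close> where \<open>x\<close> is not free in
  \<open>\<psi>\<^sup>t\<close>: the bundle semantics then supplies no successor of \<open>a\<close>, only one of the world below \<open>a\<close>,
  and it is the p-morphism property of the projection that lifts it.
\<close>

lemma free_vars_translation: "free_vars (translation x \<phi>) \<subseteq> {x}"
  by (induction \<phi>) auto

lemma csts_translation [simp]: "csts (translation x \<phi>) = {}"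
  by (induction \<phi>) auto

text \<open>The clause for \<open>FDia\<close> only moves constants that occur, so this decides
  whether the bundle semantics demands a successor of \<open>a\<close>.\<close>

lemma csts_subst_translation:
  fixes a :: 'c and \<phi> :: "'p mfm"
  shows "csts (subst x a (translation x \<phi>)) =
    (if x \<in> free_vars (translation x \<phi> :: ('p, 'c) fo) then {a} else {})"
  by (induction \<phi>) auto

text \<open>Since translations contain no constants of their own, this turns the replacement of
  constants under \<open>FDia\<close> into substitution of the successor \<open>b a\<close>.\<close>

lemma map_csts_subst: "map_csts b (subst x a \<phi>) = subst x (b a) (map_csts b \<phi>)"
proof (induction \<phi>)
  case (FPred P ts)
  have "map_trm b (trm_subst x a t) = trm_subst x (b a) (map_trm b t)" for t
    by (cases t) auto
  then show ?case
    by simp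
qed auto

lemma map_csts_translation [simp]: "map_csts b (translation x \<phi>) = translation x \<phi>"
  by (induction \<phi>) auto

lemma subst_not_free:
  assumes "x \<notin> free_vars \<phi>"
  shows "subst x a \<phi> = \<phi>"
  using assms
proof (induction \<phi>)
  case (FPred P ts)
  have "trm_subst x a t = t" if "t \<in> set ts" for t
    using FPred that by (cases t) auto
  then show ?case
    by (simp add: map_idI)
qed auto

lemma holds_FAll: "holds B I w (FAll x \<phi>) \<longleftrightarrow> (\<forall>a\<in>fiber B w. holds B I w (subst x a \<phi>))"
  by (simp add: FAll_def)

text \<open>The kernel of the projection takes the place of \<open>E\<close>, so that the truth
  lemma can be proved for an arbitrary Kripke bundle.\<close>

definition fiber_rel :: "('a, 'w) kbundle \<Rightarrow> 'a rel" where
  "fiber_rel B = {(a, b). a \<in> total B \<and> b \<in> total B \<and> proj B a = proj B b}"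

text \<open>Induction with \<open>a\<close> arbitrary, since \<open>FDia\<close> and
  \<open>FEx\<close> pass to other points. The link between \<open>V\<close> and \<open>I\<close> is
  stated pointwise, so that either one may be constructed from the other.\<close>

lemma holds_subst_translation:
  fixes B :: "('a, 'w) kbundle" and \<phi> :: "'p mfm"
  assumes B: "kripke_bundle B"
    and V: "\<And>p a. a \<in> total B \<Longrightarrow> a \<in> V p \<longleftrightarrow> [a] \<in> I (proj B a) (PredSym 1 p)"
    and "a \<in> total B"
  shows "holds B I (proj B a) (subst x a (translation x \<phi>)) \<longleftrightarrow>
    mtrue (total_rel B) (fiber_rel B) V a \<phi>"
  using \<open>a \<in> total B\<close>
proof (induction \<phi> arbitrary: a)
  case (Letter p)
  have "[Cst a] = map Cst as \<longleftrightarrow> as = [a]" for as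
    by (cases as) auto
  then show ?case
    using V[OF Letter] by auto
next
  case (MDia \<phi>)
  let ?\<psi> = "\<lambda>c. subst x c (translation x \<phi>)"
  have total: "b \<in> total B" if "(a, b) \<in> total_rel B" for b
    using B that by (auto simp: kripke_bundle_def)
  have "holds B I (proj B a) (FDia (?\<psi> a)) \<longleftrightarrow>
      (\<exists>b. (a, b) \<in> total_rel B \<and> holds B I (proj B b) (?\<psi> b))" (is "?L \<longleftrightarrow> ?R")
  proof
    assume ?L
    then obtain v b where v: "(proj B a, v) \<in> base_rel B"
      and b: "\<forall>c\<in>csts (?\<psi> a). (c, b c) \<in> total_rel B \<and> b c \<in> fiber B v"
      and h: "holds B I v (?\<psi> (b a))"
      by (auto simp: map_csts_subst)
    show ?R
    proof (cases "x \<in> free_vars (translation x \<phi> :: ('p, 'a) fo)")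
      case True
      then have "(a, b a) \<in> total_rel B" "proj B (b a) = v"
        using b by (auto simp: csts_subst_translation fiber_def)
      then show ?thesis
        using h by blast
    next
      case False
      obtain b' where "(a, b') \<in> total_rel B" "proj B b' = v"
        using B MDia.prems v unfolding kripke_bundle_def by blast
      \<comment> \<open>Neither substitution changes the formula, so \<open>h\<close> carries over
        from \<open>b a\<close> to \<open>b'\<close>.\<close>
      then show ?thesis
        using h by (auto simp: subst_not_free[OF False])
    qed
  next
    assume ?R
    then obtain b where b: "(a, b) \<in> total_rel B" "holds B I (proj B b) (?\<psi> b)"
      by blast
    have "(proj B a, proj B b) \<in> base_rel B"
      using B b(1) by (auto simp: kripke_bundle_def)
    \<comment> \<open>At most the constant \<open>a\<close> occurs, so a constant function can serve
      as the replacement.\<close>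
    moreover have "\<forall>c\<in>csts (?\<psi> a). (c, b) \<in> total_rel B \<and> b \<in> fiber B (proj B b)"
      using b(1) total by (auto simp: csts_subst_translation fiber_def)
    moreover have "holds B I (proj B b) (map_csts (\<lambda>_. b) (?\<psi> a))"
      using b(2) by (simp add: map_csts_subst)
    ultimately show ?L
      unfolding holds.simps by (intro exI[of _ "proj B b"] exI[of _ "\<lambda>_. b"] conjI)
  qed
  then show ?case
    using MDia.IH total by auto
next
  case (MEx \<phi>)
  then have "holds B I (proj B a) (subst x b (translation x \<phi>)) \<longleftrightarrow>
      mtrue (total_rel B) (fiber_rel B) V b \<phi>" if "(a, b) \<in> fiber_rel B" for b
    using that by (auto simp: fiber_rel_def)
  moreover have "b \<in> fiber B (proj B a) \<longleftrightarrow> (a, b) \<in> fiber_rel B" for b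
    using MEx.prems by (auto simp: fiber_def fiber_rel_def)
  ultimately show ?case
    by auto
qed auto

text \<open>If \<open>x\<close> is free, the closure is a single quantifier over a fiber, and the
  fibers over \<open>base B\<close> cover \<open>total B\<close>. Otherwise nothing is quantified,
  and surjectivity of the projection suffices.\<close>

lemma holds_universal_closure_translation:
  fixes B :: "('a, 'w) kbundle" and \<phi> :: "'p mfm"
  assumes "kripke_bundle B"
  shows "(\<forall>w\<in>base B. holds B I w (universal_closure (translation x \<phi>))) \<longleftrightarrow>
    (\<forall>a\<in>total B. holds B I (proj B a) (subst x a (translation x \<phi>)))"
proof -
  have base: "base B = proj B ` total B"
    using assms by (simp add: kripke_bundle_def)
  show ?thesis
  proof (cases "x \<in> free_vars (translation x \<phi> :: ('p, 'a) fo)")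
    case True
    then have "free_vars (translation x \<phi> :: ('p, 'a) fo) = {x}"
      using free_vars_translation by fastforce
    then show ?thesis
      by (auto simp: base universal_closure_def holds_FAll fiber_def)
  next
    case False
    then have "free_vars (translation x \<phi> :: ('p, 'a) fo) = {}"
      using free_vars_translation by fastforce
    then show ?thesis
      by (simp add: base universal_closure_def subst_not_free)
  qed
qed

lemma bundle_valid_translation_iff:
  fixes B :: "('a, 'w) kbundle" and \<phi> :: "'p mfm"
  assumes B: "kripke_bundle B"
  shows "bundle_valid B (translation x \<phi>) \<longleftrightarrow>
    frame_valid (total B) (total_rel B) (fiber_rel B) \<phi>" (is "?L \<longleftrightarrow> ?R")
proof
  assume L: ?L
  show ?R
    unfolding frame_valid_def
  proof (intro allI impI ballI)
    fix V :: "'p \<Rightarrow> 'a set" and a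
    assume a: "a \<in> total B"
    \<comment> \<open>Cutting \<open>V p\<close> down to the fiber makes \<open>I\<close> a bundle
      valuation; symbols not of the form \<open>PredSym 1 p\<close> get the empty set.\<close>
    define I :: "'w \<Rightarrow> 'p predsym \<Rightarrow> 'a list set"
      where "I w P = {[c] | c p. P = PredSym 1 p \<and> c \<in> V p \<and> c \<in> fiber B w}" for w P
    have "bundle_valuation B I"
      by (auto simp: bundle_valuation_def I_def)
    then have "holds B I (proj B a) (subst x a (translation x \<phi>))"
      using L a by (simp add: bundle_valid_def holds_universal_closure_translation[OF B])
    moreover have "c \<in> V p \<longleftrightarrow> [c] \<in> I (proj B c) (PredSym 1 p)" if "c \<in> total B" for c p
      using that by (simp add: I_def fiber_def)
    ultimately show "mtrue (total_rel B) (fiber_rel B) V a \<phi>"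
      using holds_subst_translation[where V = V and I = I, OF B _ a] by simp
  qed
next
  assume R: ?R
  have "holds B I (proj B a) (subst x a (translation x \<phi>))"
    if a: "a \<in> total B" for I :: "'w \<Rightarrow> 'p predsym \<Rightarrow> 'a list set" and a
  proof -
    \<comment> \<open>Each point lies in exactly one fiber, so the interpretations at all worlds
      glue to one valuation.\<close>
    define V where "V p = {c \<in> total B. [c] \<in> I (proj B c) (PredSym 1 p)}" for p
    have "mtrue (total_rel B) (fiber_rel B) V a \<phi>"
      using R a by (auto simp: frame_valid_def V_def)
    moreover have "c \<in> V p \<longleftrightarrow> [c] \<in> I (proj B c) (PredSym 1 p)" if "c \<in> total B" for c p
      using that by (simp add: V_def)
    ultimately show ?thesis
      using holds_subst_translation[where V = V and I = I, OF B _ a] by simp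
  qed
  then show ?L
    by (simp add: bundle_valid_def holds_universal_closure_translation[OF B])
qed

text \<open>The kernel of the quotient map is the equivalence relation itself.\<close>

lemma fiber_rel_frame_bundle:
  assumes "equiv X E"
  shows "fiber_rel (frame_bundle X R E) = E"
  using equiv_class_eq_iff[OF assms] by (auto simp: fiber_rel_def frame_bundle_def)

theorem theorem5p3:
  fixes X :: "'a set" and R E :: "'a rel" and x :: nat and \<phi> :: "'p mfm"
  assumes "MK_frame X R E"
  shows "frame_valid X R E \<phi> \<longleftrightarrow> bundle_valid (frame_bundle X R E) (translation x \<phi>)"
proof -
  have "fiber_rel (frame_bundle X R E) = E"
    using assms by (simp add: MK_frame_def fiber_rel_frame_bundle)
  then show ?thesis
    using bundle_valid_translation_iff[OF kripke_bundle_frame_bundle[OF assms], of x \<phi>]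
    by (simp add: frame_bundle_def)
qed

end
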